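(* Let $n_t,n_1,n_2\ge 1$ be integers, $\mathbf{H}_1\in\mathbb{R}^{n_1\times n_t}$, $\mathbf{H}_2\in\mathbb{R}^{n_2\times n_t}$, $P\ge 0$ and $\alpha\in[0,1]$. Let $\mathbf{Q}_1^{*}\in\mathbb{R}^{n_t\times n_t}$ be a symmetric positive semidefinite matrix that attains the maximum in $$\max_{\mathbf{Q}_1\succeq \mathbf{0},\ \mathrm{tr}(\mathbf{Q}_1)\le \alpha P}\ \frac12\log\frac{|\mathbf{I}+\mathbf{H}_1\mathbf{Q}_1\mathbf{H}_1^T|}{|\mathbf{I}+\mathbf{H}_2\mathbf{Q}_1\mathbf{H}_2^T|}.$$ Define $$R_2(\alpha)=\max_{\mathbf{Q}_2\succeq\mathbf{0},\ \mathrm{tr}(\mathbf{Q}_2)\le(1-\alpha)P}\left\{\frac12\log\left|\mathbf{I}+\mathbf{H}_2\mathbf{Q}_2\mathbf{H}_2^T(\mathbf{I}+\mathbf{H}_2\mathbf{Q}_1^{*}\mathbf{H}_2^T)^{-1}\right|-\frac12\log\left|\mathbf{I}+\mathbf{H}_1\mathbf{Q}_2\mathbf{H}_1^T(\mathbf{I}+\mathbf{H}_1\mathbf{Q}_1^{*}\mathbf{H}_1^T)^{-1}\right|\right\}.$$ Let $\mathbf{I}+\mathbf{H}_1\mathbf{Q}_1^{*}\mathbf{H}_1^T=\mathbf{V}_a\mathbf{\Lambda}_a\mathbf{V}_a^T$ and $\mathbf{I}+\mathbf{H}_2\mathbf{Q}_1^{*}\mathbf{H}_2^T=\mathbf{V}_b\mathbf{\Lambda}_b\mathbf{V}_b^T$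 be eigendecompositions, with $\mathbf{V}_a,\mathbf{V}_b$ orthogonal matrices of eigenvectors and $\mathbf{\Lambda}_a,\mathbf{\Lambda}_b$ diagonal matrices of eigenvalues, and set $$\mathbf{H}_1'=\mathbf{\Lambda}_a^{-1/2}\mathbf{V}_a^T\mathbf{H}_1,\qquad \mathbf{H}_2'=\mathbf{\Lambda}_b^{-1/2}\mathbf{V}_b^T\mathbf{H}_2 .$$ Then the problem defining $R_2(\alpha)$ is converted to the problem of a standard MIMO wiretap channel with legitimate-user channel matrix $\mathbf{H}_2'$, eavesdropper channel matrix $\mathbf{H}_1'$ and transmit power $(1-\alpha)P$; that is, $$R_2(\alpha)=\max_{\mathbf{Q}_2\succeq\mathbf{0},\ \mathrm{tr}(\mathbf{Q}_2)\le(1-\alpha)P}\ \frac12\log\frac{|\mathbf{I}+\mathbf{H}_2'\mathbf{Q}_2\mathbf{H}_2'^{\,T}|}{|\mathbf{I}+\mathbf{H}_1'\mathbf{Q}_2\mathbf{H}_1'^{\,T}|}.$$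
   Context: $|\cdot|$ denotes the determinant, $\mathrm{tr}$ the trace, $\mathbf{I}$ an identity matrix of the appropriate size, and $\mathbf{Q}\succeq\mathbf{0}$ means that $\mathbf{Q}$ is a (real symmetric) positive semidefinite matrix. Maximizations over $\mathbf{Q}_1,\mathbf{Q}_2$ are over real symmetric $n_t\times n_t$ matrices. For a diagonal matrix $\mathbf{\Lambda}$ with positive diagonal entries, $\mathbf{\Lambda}^{-1/2}$ is the diagonal matrix whose entries are the inverse square roots of those of $\mathbf{\Lambda}$. The (standard) Gaussian MIMO wiretap channel problem with legitimate-user channel matrix $\mathbf{H}\in\mathbb{R}^{m\times n_t}$, eavesdropper channel matrix $\mathbf{G}\in\mathbb{R}^{k\times n_t}$ and transmit power $p\ge 0$ is the problem $$\max_{\mathbf{Q}\succeq\mathbf{0},\ \mathrm{tr}(\mathbf{Q})\le p}\ \frac12\log\frac{|\mathbf{I}+\mathbf{H}\mathbf{Q}\mathbf{H}^T|}{|\mathbf{I}+\mathbf{G}\mathbf{Q}\mathbf{G}^T|}.$$ *)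

theory Defs
  imports "HOL-Analysis.Analysis"
begin

definition pos_semidef :: "real^'n^'n \<Rightarrow> bool" where
  "pos_semidef Q \<longleftrightarrow> transpose Q = Q \<and> (\<forall>x. 0 \<le> x \<bullet> (Q *v x))"

definition feasible_cov :: "real \<Rightarrow> real^'n^'n \<Rightarrow> bool" where
  "feasible_cov p Q \<longleftrightarrow> pos_semidef Q \<and> trace Q \<le> p"

definition gram_noise :: "real^'n^'m \<Rightarrow> real^'n^'n \<Rightarrow> real^'m^'m" where
  "gram_noise H Q = mat 1 + H ** Q ** transpose H"

text \<open>The maximum of \<open>f\<close> over all points satisfying \<open>P\<close>. The term is unspecified if no maximum
  is attained, so existence of a maximizer has to be stated separately.\<close>

definition max_value :: "('a \<Rightarrow> real) \<Rightarrow> ('a \<Rightarrow> bool) \<Rightarrow> real" where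
  "max_value f P = (GREATEST v. \<exists>x. P x \<and> v = f x)"

text \<open>Objective of the Gaussian MIMO wiretap channel problem: \<open>H\<close> is the channel of the
  legitimate user, \<open>G\<close> that of the eavesdropper. Rates are in nats; another base of the logarithm
  rescales all rates by the same positive constant.\<close>

definition wiretap_rate :: "real^'n^'m \<Rightarrow> real^'n^'k \<Rightarrow> real^'n^'n \<Rightarrow> real" where
  "wiretap_rate H G Q = 1/2 * ln (det (gram_noise H Q) / det (gram_noise G Q))"

definition wiretap_max :: "real^'n^'m \<Rightarrow> real^'n^'k \<Rightarrow> real \<Rightarrow> real" where
  "wiretap_max H G p = max_value (wiretap_rate H G) (feasible_cov p)"

definition user2_rate ::
  "real^'n^'n1 \<Rightarrow> real^'n^'n2 \<Rightarrow> real^'n^'n \<Rightarrow> real^'n^'n \<Rightarrow> real" where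
  "user2_rate H1 H2 Q1 Q2 =
     1/2 * ln (det (mat 1 + H2 ** Q2 ** transpose H2 ** matrix_inv (gram_noise H2 Q1)))
   - 1/2 * ln (det (mat 1 + H1 ** Q2 ** transpose H1 ** matrix_inv (gram_noise H1 Q1)))"

definition R2 ::
  "real^'n^'n1 \<Rightarrow> real^'n^'n2 \<Rightarrow> real^'n^'n \<Rightarrow> real \<Rightarrow> real \<Rightarrow> real" where
  "R2 H1 H2 Q1 P \<alpha> = max_value (user2_rate H1 H2 Q1) (feasible_cov ((1 - \<alpha>) * P))"

definition diagonal_matrix :: "real^'n^'n \<Rightarrow> bool" where
  "diagonal_matrix D \<longleftrightarrow> (\<forall>i j. i \<noteq> j \<longrightarrow> D $ i $ j = 0)"

text \<open>The equation \<open>A = V \<Lambda> V\<^sup>T\<close> with \<open>V\<close> orthogonal and \<open>\<Lambda>\<close> diagonal says that the columns of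
  \<open>V\<close> are orthonormal eigenvectors of \<open>A\<close>, with eigenvalues the diagonal entries of \<open>\<Lambda>\<close>.\<close>

definition eigendecomposition :: "real^'n^'n \<Rightarrow> real^'n^'n \<Rightarrow> real^'n^'n \<Rightarrow> bool" where
  "eigendecomposition A V \<Lambda> \<longleftrightarrow>
     orthogonal_matrix V \<and> diagonal_matrix \<Lambda> \<and> A = V ** \<Lambda> ** transpose V"

text \<open>Meant for diagonal matrices with positive diagonal entries only.\<close>

definition diag_inv_sqrt :: "real^'n^'n \<Rightarrow> real^'n^'n" where
  "diag_inv_sqrt D = (\<chi> i j. if i = j then 1 / sqrt (D $ i $ i) else 0)"

end

theory Submission
  imports Defs
begin

text \<open>Writing \<open>K = I + H Q\<^sub>1 H\<^sup>T = V \<Lambda> V\<^sup>T\<close> and \<open>S = \<Lambda>\<^sup>-\<^sup>1\<^sup>/\<^sup>2 V\<^sup>T\<close>, one has \<open>S K S\<^sup>T = I\<close>, hence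
  \<open>K\<^sup>-\<^sup>1 = S\<^sup>T S\<close> and \<open>|I + M K\<^sup>-\<^sup>1| = |K + M| |S|\<^sup>2 = |I + S M S\<^sup>T|\<close>. With \<open>M = H Q\<^sub>2 H\<^sup>T\<close> this makes
  the two objectives agree on the feasible set, and the maximum is attained there by compactness.\<close>

lemma pos_semidef_0: "pos_semidef (0 :: real^'n^'n)"
  by (simp add: pos_semidef_def transpose_def vec_eq_iff)

lemma pos_semidef_scaleR:
  assumes "pos_semidef Q" "0 \<le> t"
  shows "pos_semidef (t *\<^sub>R Q)"
  using assms
  by (auto simp: pos_semidef_def transpose_def vec_eq_iff scaleR_matrix_vector_assoc[symmetric])

text \<open>The added term is the quadratic form of \<open>Q\<close> at
  \<open>transpose H *v x\<close>, hence nonnegative. This bound yields both the nonsingularity of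
  \<open>gram_noise H Q\<close> and the positivity of its eigenvalues.\<close>

lemma gram_noise_inner_ge:
  assumes "pos_semidef Q"
  shows "x \<bullet> x \<le> x \<bullet> (gram_noise H Q *v x)"
proof -
  have "x \<bullet> (gram_noise H Q *v x) = x \<bullet> x + x \<bullet> (H *v (Q *v (transpose H *v x)))"
    by (simp add: gram_noise_def matrix_vector_mult_add_rdistrib inner_add_right
        matrix_vector_mul_assoc matrix_mul_assoc del: transpose_matrix_vector)
  also have "x \<bullet> (H *v (Q *v (transpose H *v x))) = (transpose H *v x) \<bullet> (Q *v (transpose H *v x))"
    by (simp add: dot_lmul_matrix[symmetric])
  finally show ?thesis
    using assms by (simp add: pos_semidef_def)
qed

lemma continuous_on_matrix_mult [continuous_intros]:
  fixes f :: "'a::topological_space \<Rightarrow> real^'n^'m" and g :: "'a \<Rightarrow> real^'k^'n"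
  assumes "continuous_on S f" "continuous_on S g"
  shows "continuous_on S (\<lambda>x. f x ** g x)"
  unfolding matrix_matrix_mult_def by (intro continuous_intros assms)

lemma continuous_on_det [continuous_intros]:
  fixes f :: "'a::topological_space \<Rightarrow> real^'n^'n"
  assumes "continuous_on S f"
  shows "continuous_on S (\<lambda>x. det (f x))"
  unfolding det_def by (intro continuous_intros assms)

lemma continuous_on_gram_noise [continuous_intros]:
  assumes "continuous_on S f"
  shows "continuous_on S (\<lambda>x. gram_noise H (f x))"
  unfolding gram_noise_def by (intro continuous_intros assms)

lemma det_gram_noise_nonzero:
  assumes "pos_semidef Q"
  shows "det (gram_noise H Q) \<noteq> 0"
proof -
  have "x = 0" if "gram_noise H Q *v x = 0" for x
    using gram_noise_inner_ge[OF assms, of x H] inner_ge_zero[of x] that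
    by (simp del: inner_ge_zero)
  then show ?thesis
    using invertible_det_nz invertible_left_inverse matrix_left_invertible_ker by blast
qed

text \<open>Along the segment from \<open>0\<close> to \<open>Q\<close> the determinant starts at \<open>1\<close> and never vanishes.\<close>

lemma det_gram_noise_pos:
  assumes "pos_semidef Q"
  shows "0 < det (gram_noise H Q)"
proof (rule ccontr)
  let ?d = "\<lambda>t::real. det (gram_noise H (t *\<^sub>R Q))"
  assume "\<not> 0 < det (gram_noise H Q)"
  then have "?d 1 \<le> 0" by simp
  moreover have "0 \<le> ?d 0" by (simp add: gram_noise_def)
  moreover have "continuous_on {0..1} ?d" by (intro continuous_intros)
  ultimately obtain t where "0 \<le> t" "?d t = 0"
    using IVT2'[of ?d 1 0 0] by auto
  then show False
    using det_gram_noise_nonzero pos_semidef_scaleR[OF assms] by blast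
qed

text \<open>Testing the quadratic form on the sum and the difference of two basis vectors bounds
  twice the modulus of an entry by two diagonal entries. Each of these is at most the trace because
  the diagonal is nonnegative.\<close>

lemma pos_semidef_entry_le_trace:
  fixes Q :: "real^'n^'n"
  assumes "pos_semidef Q"
  shows "\<bar>Q $ i $ j\<bar> \<le> trace Q"
proof -
  have quad: "axis k 1 \<bullet> (Q *v axis l 1) = Q $ k $ l" for k l
    by (simp add: matrix_vector_mul_component inner_axis inner_axis' inner_commute)
  have sym: "Q $ j $ i = Q $ i $ j"
    using assms by (auto simp: pos_semidef_def transpose_def vec_eq_iff)
  have nonneg: "0 \<le> x \<bullet> (Q *v x)" for x
    using assms by (simp add: pos_semidef_def)
  have diag: "0 \<le> Q $ k $ k" for k
    using nonneg[of "axis k 1"] by (simp add: quad)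
  have diag_le: "Q $ k $ k \<le> trace Q" for k
    unfolding trace_def by (rule member_le_sum) (auto simp: diag)
  have "0 \<le> Q $ i $ i + 2 * Q $ i $ j + Q $ j $ j"
    using nonneg[of "axis i 1 + axis j 1"]
    by (simp add: matrix_vector_right_distrib inner_add_left inner_add_right quad sym)
  moreover have "0 \<le> Q $ i $ i - 2 * Q $ i $ j + Q $ j $ j"
    using nonneg[of "axis i 1 - axis j 1"]
    by (simp add: matrix_vector_mult_diff_distrib inner_diff_left inner_diff_right quad sym)
  ultimately show ?thesis
    using diag_le[of i] diag_le[of j] by linarith
qed

lemma compact_feasible_cov: "compact {Q :: real^'n^'n. feasible_cov p Q}"
proof -
  have "bounded {Q :: real^'n^'n. feasible_cov p Q}"
  proof (rule boundedI)
    fix Q :: "real^'n^'n"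
    assume "Q \<in> {Q. feasible_cov p Q}"
    then have entry: "\<bar>Q $ i $ j\<bar> \<le> p" for i j
      using pos_semidef_entry_le_trace[of Q i j] by (auto simp: feasible_cov_def)
    have "norm Q \<le> (\<Sum>i\<in>UNIV. norm (Q $ i))"
      by (simp add: norm_vec_def L2_set_le_sum)
    also have "\<dots> \<le> (\<Sum>i\<in>(UNIV::'n set). \<Sum>j\<in>(UNIV::'n set). p)"
      by (intro sum_mono order_trans[OF norm_le_l1_cart] entry)
    finally show "norm Q \<le> (\<Sum>i\<in>(UNIV::'n set). \<Sum>j\<in>(UNIV::'n set). p)" .
  qed
  \<comment> \<open>Unfolded, feasibility is an intersection of equalities and non-strict
    inequalities between continuous functions of \<open>Q\<close>, one inequality for each test
    vector.\<close>
  moreover have "closed {Q :: real^'n^'n. feasible_cov p Q}"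
    unfolding feasible_cov_def pos_semidef_def transpose_def trace_def matrix_vector_mult_def
    by (intro closed_Collect_conj closed_Collect_all closed_Collect_le closed_Collect_eq
        continuous_intros)
  ultimately show ?thesis
    by (simp add: compact_eq_bounded_closed)
qed

text \<open>A continuous function on a nonempty compact set attains its supremum. Nonvanishing
  determinants give continuity of the quotient and of its logarithm; \<open>0 \<le> p\<close> makes
  the zero matrix feasible.\<close>

lemma wiretap_rate_attains_max:
  assumes "0 \<le> p"
  shows "\<exists>Q. is_arg_max (wiretap_rate H G) (feasible_cov p) Q"
proof -
  have "continuous_on {Q. feasible_cov p Q} (wiretap_rate H G)"
    unfolding wiretap_rate_def[abs_def]
    by (intro continuous_intros)
      (auto simp: feasible_cov_def det_gram_noise_nonzero)
  moreover have "feasible_cov p 0"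
    using assms by (simp add: feasible_cov_def pos_semidef_0 trace_def)
  ultimately show ?thesis
    using continuous_attains_sup[OF compact_feasible_cov, of p "wiretap_rate H G"]
    by (fastforce simp: is_arg_max_linorder)
qed

text \<open>The diagonal entry is the value of the quadratic form at a column of \<open>V\<close>, a
  unit vector, so it is even at least 1. This makes \<open>diag_inv_sqrt L\<close> a genuine inverse
  square root.\<close>

lemma eigenvalue_gram_noise_pos:
  assumes "pos_semidef Q" and "eigendecomposition (gram_noise H Q) V L"
  shows "0 < L $ i $ i"
proof -
  let ?e = "axis i 1"
  have V: "transpose V ** V = mat 1" and K: "gram_noise H Q = V ** L ** transpose V"
    using assms(2) by (auto simp: eigendecomposition_def orthogonal_matrix)
  have isom: "(V *v x) \<bullet> (V *v y) = x \<bullet> y" for x y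
  proof -
    have "(V *v x) \<bullet> (V *v y) = x \<bullet> (transpose V *v (V *v y))"
      using dot_lmul_matrix[of x "transpose V" "V *v y"] by simp
    then show ?thesis
      by (simp add: matrix_vector_mul_assoc V)
  qed
  have "gram_noise H Q *v (V *v ?e) = V *v (L *v ((transpose V ** V) *v ?e))"
    by (simp add: K matrix_vector_mul_assoc matrix_mul_assoc)
  then have "(V *v ?e) \<bullet> (gram_noise H Q *v (V *v ?e)) = ?e \<bullet> (L *v ?e)"
    by (simp add: V isom)
  also have "\<dots> = L $ i $ i"
    by (simp add: matrix_vector_mul_component inner_axis inner_axis' inner_commute)
  finally show ?thesis
    using gram_noise_inner_ge[OF assms(1), of "V *v ?e" H]
    by (simp add: isom inner_axis_axis)
qed

lemma diag_inv_sqrt_whitens: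
  assumes "diagonal_matrix L" and "\<And>i. 0 < L $ i $ i"
  shows "diag_inv_sqrt L ** L ** diag_inv_sqrt L = mat 1"
proof -
  have "(diag_inv_sqrt L ** L ** diag_inv_sqrt L) $ i $ j = mat 1 $ i $ j" for i j
  proof -
    have "(diag_inv_sqrt L ** L ** diag_inv_sqrt L) $ i $ j
        = 1 / sqrt (L $ i $ i) * L $ i $ j * (1 / sqrt (L $ j $ j))"
      by (simp add: matrix_matrix_mult_def diag_inv_sqrt_def if_distrib if_distribR
          cong: if_cong)
    then show ?thesis
      using assms(1) assms(2)[of i] by (auto simp: mat_def diagonal_matrix_def)
  qed
  then show ?thesis by (simp add: vec_eq_iff)
qed

lemma whitening_eigendecomposition:
  assumes "eigendecomposition K V L" and "\<And>i. 0 < L $ i $ i"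
  defines "S \<equiv> diag_inv_sqrt L ** transpose V"
  shows "S ** K ** transpose S = mat 1"
proof -
  have V: "transpose V ** V = mat 1" and K: "K = V ** L ** transpose V"
    and L: "diagonal_matrix L"
    using assms(1) by (auto simp: eigendecomposition_def orthogonal_matrix)
  have D: "transpose (diag_inv_sqrt L) = diag_inv_sqrt L"
    by (simp add: transpose_def diag_inv_sqrt_def vec_eq_iff)
  have "S ** K ** transpose S
      = diag_inv_sqrt L ** (transpose V ** V) ** L ** (transpose V ** V) ** diag_inv_sqrt L"
    by (simp add: S_def K D matrix_transpose_mul matrix_mul_assoc)
  also have "\<dots> = mat 1"
    by (simp add: V diag_inv_sqrt_whitens[OF L assms(2)])
  finally show ?thesis .
qed

lemma matrix_inv_eqI:
  fixes A B :: "real^'n^'n"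
  assumes "A ** B = mat 1"
  shows "matrix_inv A = B"
proof -
  have BA: "B ** A = mat 1"
    using assms matrix_left_right_inverse by blast
  have "A ** matrix_inv A = mat 1"
    \<comment> \<open>\<open>matrix_inv\<close> is a choice among two-sided inverses, and
      \<open>B\<close> witnesses that one exists.\<close>
    unfolding matrix_inv_def by (rule someI2[of _ B]) (auto simp: assms BA)
  then have "B ** (A ** matrix_inv A) = B" by simp
  then show ?thesis
    by (simp add: matrix_mul_assoc BA)
qed

lemma matrix_add_rdistrib: "(A + B) ** C = A ** C + B ** (C :: real^'k^'n)"
  by (simp add: matrix_matrix_mult_def vec_eq_iff distrib_right sum.distrib)

lemma det_whitening:
  fixes K M S :: "real^'n^'n"
  assumes "S ** K ** transpose S = mat 1"
  shows "det (mat 1 + M ** matrix_inv K) = det (mat 1 + S ** M ** transpose S)"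
proof -
  have "S ** (K ** transpose S) = mat 1"
    using assms by (simp add: matrix_mul_assoc)
  \<comment> \<open>For square matrices a right inverse of \<open>S\<close> is also a left inverse;
    this brings the two factors of \<open>S\<close> together.\<close>
  then have "(K ** transpose S) ** S = mat 1"
    using matrix_left_right_inverse by blast
  then have KS: "K ** (transpose S ** S) = mat 1"
    by (simp add: matrix_mul_assoc)
  then have inv: "matrix_inv K = transpose S ** S"
    by (rule matrix_inv_eqI)
  have "mat 1 + M ** matrix_inv K = (K + M) ** (transpose S ** S)"
    by (simp add: inv KS matrix_add_rdistrib)
  \<comment> \<open>Determinants of the factors commute, so \<open>S\<close> may move from the right
    end to the left.\<close>
  then have "det (mat 1 + M ** matrix_inv K) = det (S ** (K + M) ** transpose S)"
    by (simp add: det_mul)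
  also have "S ** (K + M) ** transpose S = mat 1 + S ** M ** transpose S"
    by (simp add: assms matrix_add_ldistrib matrix_add_rdistrib)
  finally show ?thesis .
qed

text \<open>The whitening matrix is absorbed into the channel: with
  \<open>M = H ** Q ** transpose H\<close>, the product \<open>S ** M ** transpose S\<close> is the
  same expression for the channel \<open>S ** H\<close>.\<close>

lemma det_gram_noise_whitened:
  assumes "pos_semidef Q1" and "eigendecomposition (gram_noise H Q1) V L"
  shows "det (mat 1 + H ** Q ** transpose H ** matrix_inv (gram_noise H Q1))
       = det (gram_noise (diag_inv_sqrt L ** transpose V ** H) Q)"
proof -
  have "0 < L $ i $ i" for i
    using eigenvalue_gram_noise_pos assms by blast
  from det_whitening[OF whitening_eigendecomposition[OF assms(2) this]]
  show ?thesis
    by (simp add: gram_noise_def matrix_transpose_mul matrix_mul_assoc)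
qed

theorem theorem1:
  fixes H1 :: "real^'nt^'n1" and H2 :: "real^'nt^'n2"
    and Q1 :: "real^'nt^'nt"
    and Va \<Lambda>a :: "real^'n1^'n1" and Vb \<Lambda>b :: "real^'n2^'n2"
    and H1' :: "real^'nt^'n1" and H2' :: "real^'nt^'n2"
    and P \<alpha> :: real
  assumes "0 \<le> P" and "0 \<le> \<alpha>" and "\<alpha> \<le> 1"
    and "is_arg_max (wiretap_rate H1 H2) (feasible_cov (\<alpha> * P)) Q1"
    and "eigendecomposition (mat 1 + H1 ** Q1 ** transpose H1) Va \<Lambda>a"
    and "eigendecomposition (mat 1 + H2 ** Q1 ** transpose H2) Vb \<Lambda>b"
    and "H1' = diag_inv_sqrt \<Lambda>a ** transpose Va ** H1"
    and "H2' = diag_inv_sqrt \<Lambda>b ** transpose Vb ** H2"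
  shows "(\<exists>Q2. is_arg_max (user2_rate H1 H2 Q1) (feasible_cov ((1 - \<alpha>) * P)) Q2)
       \<and> (\<exists>Q2. is_arg_max (wiretap_rate H2' H1') (feasible_cov ((1 - \<alpha>) * P)) Q2)
       \<and> R2 H1 H2 Q1 P \<alpha> = wiretap_max H2' H1' ((1 - \<alpha>) * P)"
proof -
  let ?p = "(1 - \<alpha>) * P"
  have Q1: "pos_semidef Q1"
    using assms(4) by (simp add: is_arg_max_def feasible_cov_def)
  have eq: "user2_rate H1 H2 Q1 Q = wiretap_rate H2' H1' Q" if "feasible_cov ?p Q" for Q
  proof -
    \<comment> \<open>Positivity is what lets the logarithm of the quotient split into a
      difference.\<close>
    have "0 < det (gram_noise H1' Q)" "0 < det (gram_noise H2' Q)"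
      using that by (auto simp: feasible_cov_def det_gram_noise_pos)
    moreover have "det (mat 1 + H1 ** Q ** transpose H1 ** matrix_inv (gram_noise H1 Q1))
        = det (gram_noise H1' Q)"
      unfolding assms(7) by (rule det_gram_noise_whitened[OF Q1 assms(5)[folded gram_noise_def]])
    moreover have "det (mat 1 + H2 ** Q ** transpose H2 ** matrix_inv (gram_noise H2 Q1))
        = det (gram_noise H2' Q)"
      unfolding assms(8) by (rule det_gram_noise_whitened[OF Q1 assms(6)[folded gram_noise_def]])
    ultimately show ?thesis
      by (simp add: user2_rate_def wiretap_rate_def ln_div)
  qed
  \<comment> \<open>Both notions of maximum evaluate the objective at feasible points only, so
    agreement there transfers maximizers and, below, the maximal value.\<close>
  have "is_arg_max (user2_rate H1 H2 Q1) (feasible_cov ?p) Q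
      \<longleftrightarrow> is_arg_max (wiretap_rate H2' H1') (feasible_cov ?p) Q" for Q
    by (auto simp: is_arg_max_def eq)
  moreover have "\<exists>Q. is_arg_max (wiretap_rate H2' H1') (feasible_cov ?p) Q"
    using assms(1,3) by (intro wiretap_rate_attains_max) simp
  moreover have "R2 H1 H2 Q1 P \<alpha> = wiretap_max H2' H1' ?p"
    unfolding R2_def wiretap_max_def max_value_def by (simp add: eq cong: conj_cong)
  ultimately show ?thesis by blast
qed

end
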